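(* Let $n\ge 1$ and take $m=1$, so that the group is the symmetric group $S_n$. Then for every $\pi\in S_n$ the flag major index of $\pi$ equals the major index of $\pi$: $$\text{flag-major}(\pi)=\text{major}(\pi).$$
   Context: Permutations $\pi\in S_n$ act on $\{1,\dots,n\}$, and products are composed from right to left: $(\pi\sigma)(j)=\pi(\sigma(j))$. The major index $\text{major}(\pi)$ of $\pi\in S_n$ is the sum (possibly zero) of all indices $1\le i<n$ for which $\pi(i)>\pi(i+1)$. For $1\le i<n$ let $s_i=(i,i+1)$ be the adjacent transposition, and (since $m=1$) let $s_0$ be the identity. Put $t_i:=s_i s_{i-1}\cdots s_1 s_0$ for $0\le i\le n-1$; thus $t_0$ is the identity. Every $\pi\in S_n$ has a unique representation $\pi=t_{n-1}^{k_{n-1}}t_{n-2}^{k_{n-2}}\cdots t_1^{k_1}t_0^{k_0}$ with integers $0\le k_i<i+1$ for all $i$. The flag major index is $\text{flag-major}(\pi):=\sum_{i=0}^{n-1}k_i$ for these $k_i$. *)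

theory Defs
  imports "HOL-Combinatorics.Permutations" "HOL-Library.FuncSet"
begin

definition major :: "nat \<Rightarrow> (nat \<Rightarrow> nat) \<Rightarrow> nat" where
  "major n \<pi> = \<Sum>{i. 1 \<le> i \<and> i < n \<and> \<pi> i > \<pi> (i + 1)}"

definition s :: "nat \<Rightarrow> nat \<Rightarrow> nat" where
  "s i = (if i = 0 then id else transpose i (i + 1))"

primrec t :: "nat \<Rightarrow> nat \<Rightarrow> nat" where
  "t 0 = s 0"
| "t (Suc i) = s (Suc i) \<circ> t i"

text \<open>\<open>flag_prod k n\<close> is the product
  \<open>t (n-1) ^^ k (n-1) \<circ> \<dots> \<circ> t 1 ^^ k 1 \<circ> t 0 ^^ k 0\<close>.\<close>

primrec flag_prod :: "(nat \<Rightarrow> nat) \<Rightarrow> nat \<Rightarrow> nat \<Rightarrow> nat" where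
  "flag_prod k 0 = id"
| "flag_prod k (Suc i) = (t i ^^ k i) \<circ> flag_prod k i"

text \<open>Only \<open>k 0, \<dots>, k (n-1)\<close> are meaningful; the extensional function space
  fixes the other values, so that the representation is unique as a function.\<close>

definition flag_exponents :: "nat \<Rightarrow> (nat \<Rightarrow> nat) \<Rightarrow> nat \<Rightarrow> nat" where
  "flag_exponents n \<pi> =
     (THE k. k \<in> (\<Pi>\<^sub>E i\<in>{..<n}. {..<i + 1}) \<and> \<pi> = flag_prod k n)"

definition flag_major :: "nat \<Rightarrow> (nat \<Rightarrow> nat) \<Rightarrow> nat" where
  "flag_major n \<pi> = (\<Sum>i<n. flag_exponents n \<pi> i)"

end

theory Submission
  imports Defs
begin

text \<open>
  The element \<open>t i\<close> is the cyclic shift \<open>v \<mapsto> v - 1\<close> of \<open>{1..i+1}\<close>, with \<open>1\<close> sent to \<open>i+1\<close>; composing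
  it on the left shifts the values of a permutation cyclically. Only the order relations involving
  the value \<open>1\<close>, which becomes the maximum, are changed. If that value sits at a position \<open>p \<le> i\<close>,
  the descent at \<open>p - 1\<close> (absent if \<open>p = 1\<close>) moves to \<open>p\<close>, so each application of \<open>t i\<close> raises the
  major index by exactly one (\<open>major_t_comp\<close>).

  If \<open>\<sigma>\<close> fixes \<open>i+1\<close>, the first \<open>i\<close> shifts take the last value from \<open>i+1\<close> down to \<open>1\<close>, so the value
  \<open>1\<close> is not in the last position before any of them. Hence \<open>major (t i ^^ k \<circ> \<sigma>) = major \<sigma> + k\<close> for
  \<open>k \<le> i\<close>, and by induction the major index of a flag product is the sum of its exponents
  (\<open>major_flag_prod\<close>).

  The same motion of the last value gives the unique representation: \<open>k = i + 1 - \<pi> (i+1)\<close>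
  is the only exponent for which undoing \<open>t i ^^ k\<close> yields a permutation fixing \<open>i+1\<close>.
\<close>

lemma t_apply:
  "t i j = (if j = 1 then i + 1 else if 2 \<le> j \<and> j \<le> i + 1 then j - 1 else j)"
  by (induction i arbitrary: j) (auto simp: s_def transpose_def)

lemma t_permutes: "t i permutes {1..Suc i}"
proof (induction i)
  case 0
  have "t 0 = id" by (simp only: t.simps s_def refl if_True)
  then show ?case by (simp only: permutes_id)
next
  case (Suc i)
  have "t i permutes {1..Suc (Suc i)}"
    using Suc by (rule permutes_subset) auto
  moreover have "s (Suc i) permutes {1..Suc (Suc i)}"
    by (simp add: s_def permutes_swap_id)
  ultimately show ?case unfolding t.simps by (rule permutes_compose)
qed

lemma t_funpow_permutes: "(t i ^^ k) permutes {1..Suc i}"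
proof (induction k)
  case 0
  show ?case unfolding funpow.simps by (rule permutes_id)
next
  case (Suc k)
  then show ?case unfolding funpow.simps using t_permutes by (rule permutes_compose)
qed

lemma t_funpow_last:
  assumes "k \<le> i"
  shows "(t i ^^ k) (Suc i) = Suc i - k"
  using assms by (induction k) (auto simp: t_apply)

lemma permutes_fix_last:
  assumes "\<sigma> permutes {1..Suc i}" "\<sigma> (Suc i) = Suc i"
  shows "\<sigma> permutes {1..i}"
proof -
  have "\<sigma> x = x" if "x \<in> {1..Suc i} - {1..i}" for x
  proof -
    from that have "x = Suc i" by auto
    with assms(2) show ?thesis by simp
  qed
  with assms(1) show ?thesis by (rule permutes_superset)
qed

text \<open>
  The hypothesis on the last value puts the value \<open>1\<close> at a position \<open>p\<close> that has a right neighbour.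
\<close>
lemma major_t_comp:
  assumes \<sigma>: "\<sigma> permutes {1..Suc i}" and last: "\<sigma> (Suc i) \<noteq> 1"
  shows "major (Suc i) (t i \<circ> \<sigma>) = major (Suc i) \<sigma> + 1"
proof -
  define p where "p = inv \<sigma> 1"
  define D where "D = {j. 1 \<le> j \<and> j < Suc i \<and> \<sigma> j > \<sigma> (j + 1)}"
  have \<sigma>_p: "\<sigma> p = 1" using \<sigma> by (simp add: p_def permutes_inverses)
  have "p \<in> {1..Suc i}"
    using permutes_in_image[OF \<sigma>, of p] \<sigma>_p by simp
  moreover have "p \<noteq> Suc i" using \<sigma>_p last by auto
  ultimately have p: "1 \<le> p" "p \<le> i" by auto
  have range: "1 \<le> \<sigma> j" "\<sigma> j \<le> Suc i" if "1 \<le> j" "j \<le> Suc i" for j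
    using permutes_in_image[OF \<sigma>, of j] that by auto
  have one: "\<sigma> j = 1 \<longleftrightarrow> j = p" for j
    using permutes_inj[OF \<sigma>] \<sigma>_p by (metis injD)
  have shift: "(t i \<circ> \<sigma>) j = (if j = p then Suc i else \<sigma> j - 1)" if "1 \<le> j" "j \<le> Suc i" for j
    using range[OF that] one[of j] by (auto simp: t_apply)
  have iff: "(t i \<circ> \<sigma>) j > (t i \<circ> \<sigma>) (j + 1) \<longleftrightarrow> j = p \<or> (j \<in> D \<and> j \<noteq> p - 1)"
    if j: "1 \<le> j" "j < Suc i" for j
  proof -
    have "j \<in> D \<longleftrightarrow> \<sigma> j > \<sigma> (j + 1)" using j by (simp add: D_def)
    then show ?thesis
      using shift[of j] shift[of "j + 1"] range[of j] range[of "j + 1"] one[of j] one[of "j + 1"] j p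
      by auto
  qed
  have D': "{j. 1 \<le> j \<and> j < Suc i \<and> (t i \<circ> \<sigma>) j > (t i \<circ> \<sigma>) (j + 1)} = insert p (D - {p - 1})"
  proof -
    have "D \<subseteq> {1..<Suc i}" by (auto simp: D_def)
    then show ?thesis using iff p by auto
  qed
  have "finite D" by (simp add: D_def)
  have "p \<notin> D" using range[of "p + 1"] \<sigma>_p p by (auto simp: D_def)
  \<comment> \<open>If \<open>p = 1\<close>, removing \<open>p - 1 = 0\<close> changes neither the set nor the sum.\<close>
  have "\<Sum>D = \<Sum>(D - {p - 1}) + (p - 1)"
  proof (cases "p = 1")
    case True
    then have "p - 1 \<notin> D" by (simp add: D_def)
    then show ?thesis using True by simp
  next
    case False
    then have "\<sigma> (p - 1) > 1"
      using range(1)[of "p - 1"] one[of "p - 1"] p by fastforce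
    then have "p - 1 \<in> D" using False p \<sigma>_p by (auto simp: D_def)
    then show ?thesis using \<open>finite D\<close> by (simp add: sum.remove)
  qed
  moreover have "\<Sum>(insert p (D - {p - 1})) = p + \<Sum>(D - {p - 1})"
    using \<open>finite D\<close> \<open>p \<notin> D\<close> by simp
  ultimately have "\<Sum>(insert p (D - {p - 1})) = \<Sum>D + 1" using p by simp
  then show ?thesis unfolding major_def D' D_def by simp
qed

text \<open>
  Before the shift number \<open>k + 1 \<le> i\<close> the last value is \<open>i + 1 - k \<ge> 2\<close>, so the single-shift count
  applies every time. For \<open>k = i + 1\<close> it would fail: the last value is then \<open>1\<close>, and \<open>t i ^^ (i + 1)\<close>
  is the identity.
\<close>
lemma major_t_funpow_comp:
  assumes \<sigma>: "\<sigma> permutes {1..Suc i}" and last: "\<sigma> (Suc i) = Suc i" and "k \<le> i"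
  shows "major (Suc i) ((t i ^^ k) \<circ> \<sigma>) = major (Suc i) \<sigma> + k"
  using \<open>k \<le> i\<close>
proof (induction k)
  case 0
  show ?case by simp
next
  case (Suc k)
  have "((t i ^^ k) \<circ> \<sigma>) permutes {1..Suc i}"
    using \<sigma> t_funpow_permutes by (rule permutes_compose)
  moreover have "((t i ^^ k) \<circ> \<sigma>) (Suc i) \<noteq> 1"
    using Suc.prems last by (simp add: t_funpow_last)
  ultimately have "major (Suc i) (t i \<circ> ((t i ^^ k) \<circ> \<sigma>)) = major (Suc i) ((t i ^^ k) \<circ> \<sigma>) + 1"
    by (rule major_t_comp)
  then show ?case using Suc by (simp add: comp_def)
qed

lemma major_fix_last:
  assumes "\<sigma> permutes {1..i}"
  shows "major (Suc i) \<sigma> = major i \<sigma>"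
proof -
  have "\<not> \<sigma> i > \<sigma> (i + 1)" if "1 \<le> i"
    using permutes_not_in[OF assms, of "i + 1"] permutes_in_image[OF assms, of i] that by simp
  then have "{j. 1 \<le> j \<and> j < Suc i \<and> \<sigma> j > \<sigma> (j + 1)} = {j. 1 \<le> j \<and> j < i \<and> \<sigma> j > \<sigma> (j + 1)}"
    by (auto simp: less_Suc_eq)
  then show ?thesis by (simp add: major_def)
qed

lemma flag_prod_permutes: "flag_prod k n permutes {1..n}"
proof (induction n)
  case 0
  show ?case by (simp only: flag_prod.simps permutes_id)
next
  case (Suc n)
  have "flag_prod k n permutes {1..Suc n}"
    using Suc by (rule permutes_subset) auto
  then show ?case
    unfolding flag_prod.simps using t_funpow_permutes by (rule permutes_compose)
qed

lemma flag_prod_fix_last: "flag_prod k n (Suc n) = Suc n"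
  by (rule permutes_not_in[OF flag_prod_permutes]) simp

lemma major_flag_prod:
  assumes "\<And>i. i < n \<Longrightarrow> k i \<le> i"
  shows "major n (flag_prod k n) = (\<Sum>i<n. k i)"
  using assms
proof (induction n)
  case 0
  show ?case by (simp add: major_def)
next
  case (Suc n)
  have "flag_prod k n permutes {1..Suc n}"
    using flag_prod_permutes by (rule permutes_subset) auto
  then have "major (Suc n) (flag_prod k (Suc n)) = major (Suc n) (flag_prod k n) + k n"
    unfolding flag_prod.simps
    using flag_prod_fix_last by (rule major_t_funpow_comp) (simp add: Suc.prems)
  also have "\<dots> = (\<Sum>i<n. k i) + k n"
    using Suc by (simp add: major_fix_last[OF flag_prod_permutes])
  finally show ?case by (simp only: sum.lessThan_Suc)
qed

lemma flag_prod_cong: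
  assumes "\<And>i. i < n \<Longrightarrow> k i = k' i"
  shows "flag_prod k n = flag_prod k' n"
  using assms by (induction n) auto

lemma flag_prod_surj:
  assumes "\<pi> permutes {1..n}"
  shows "\<exists>k. (\<forall>i<n. k i \<le> i) \<and> \<pi> = flag_prod k n"
  using assms
proof (induction n arbitrary: \<pi>)
  case 0
  then show ?case by simp
next
  case (Suc n)
  have "\<pi> (Suc n) \<in> {1..Suc n}"
    using permutes_in_image[OF Suc.prems, of "Suc n"] by simp
  \<comment> \<open>\<open>t n ^^ c\<close> sends \<open>n + 1\<close> to \<open>n + 1 - c\<close>, so this exponent makes \<open>\<sigma>\<close> below fix \<open>n + 1\<close>.\<close>
  define c where "c = Suc n - \<pi> (Suc n)"
  have c: "c \<le> n" "\<pi> (Suc n) = Suc n - c"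
    using \<open>\<pi> (Suc n) \<in> _\<close> by (auto simp: c_def)
  define \<sigma> where "\<sigma> = inv (t n ^^ c) \<circ> \<pi>"
  have "\<sigma> permutes {1..Suc n}"
    unfolding \<sigma>_def using Suc.prems t_funpow_permutes by (intro permutes_compose permutes_inv)
  moreover have "\<sigma> (Suc n) = Suc n"
    using c t_funpow_last[OF c(1)] permutes_inverses(2)[OF t_funpow_permutes, of c n "Suc n"]
    by (simp add: \<sigma>_def)
  ultimately have "\<sigma> permutes {1..n}" by (rule permutes_fix_last)
  then obtain k where k: "\<And>i. i < n \<Longrightarrow> k i \<le> i" "\<sigma> = flag_prod k n"
    using Suc.IH by blast
  have "\<pi> = (t n ^^ c) \<circ> \<sigma>"
    by (simp add: \<sigma>_def o_assoc permutes_inv_o[OF t_funpow_permutes])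
  also have "\<sigma> = flag_prod (k(n := c)) n"
    unfolding k(2) by (rule flag_prod_cong) simp
  finally have "\<pi> = flag_prod (k(n := c)) (Suc n)"
    by (simp only: flag_prod.simps fun_upd_same)
  moreover have "\<forall>i<Suc n. (k(n := c)) i \<le> i" using k(1) c(1) by auto
  ultimately show ?case by blast
qed

lemma flag_prod_inj:
  assumes "\<And>i. i < n \<Longrightarrow> k i \<le> i" "\<And>i. i < n \<Longrightarrow> k' i \<le> i"
    and "flag_prod k n = flag_prod k' n" and "i < n"
  shows "k i = k' i"
  using assms
proof (induction n arbitrary: i)
  case 0
  then show ?case by simp
next
  case (Suc n)
  have bounds: "k n \<le> n" "k' n \<le> n" using Suc.prems by auto
  have "flag_prod k (Suc n) (Suc n) = flag_prod k' (Suc n) (Suc n)"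
    using Suc.prems(3) by (rule fun_cong)
  then have last: "k n = k' n"
    using bounds by (simp add: flag_prod_fix_last t_funpow_last)
  have "inj (t n ^^ k n)" using t_funpow_permutes by (rule permutes_inj)
  moreover have "(t n ^^ k n) (flag_prod k n j) = (t n ^^ k n) (flag_prod k' n j)" for j
    using fun_cong[OF Suc.prems(3), of j] last by simp
  ultimately have "flag_prod k n = flag_prod k' n"
    by (intro ext) (rule injD)
  with Suc last show ?case by (cases "i = n") auto
qed

lemma flag_exponents_flag_prod:
  assumes "\<pi> permutes {1..n}"
  shows "\<And>i. i < n \<Longrightarrow> flag_exponents n \<pi> i \<le> i"
    and "flag_prod (flag_exponents n \<pi>) n = \<pi>"
proof -
  let ?P = "\<lambda>k. k \<in> (\<Pi>\<^sub>E i\<in>{..<n}. {..<i + 1}) \<and> \<pi> = flag_prod k n"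
  obtain k where k: "\<And>i. i < n \<Longrightarrow> k i \<le> i" "\<pi> = flag_prod k n"
    using flag_prod_surj[OF assms] by blast
  have "flag_prod (restrict k {..<n}) n = flag_prod k n"
    by (rule flag_prod_cong) simp
  then have "?P (restrict k {..<n})"
    using k by (auto simp: less_Suc_eq_le)
  moreover have "k' = k''" if P: "?P k'" "?P k''" for k' k''
  proof -
    have bounds: "\<And>j. j < n \<Longrightarrow> k' j \<le> j" "\<And>j. j < n \<Longrightarrow> k'' j \<le> j"
      using P by (auto simp: PiE_iff less_Suc_eq_le)
    have eq: "flag_prod k' n = flag_prod k'' n"
      using P by (elim conjE) (rule trans[OF sym])
    have "k' i = k'' i" if "i < n" for i
      using bounds eq that by (rule flag_prod_inj)
    then show ?thesis using P by (intro PiE_ext[of k' "{..<n}" "\<lambda>i. {..<i + 1}" k'']) auto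
  qed
  ultimately have "\<exists>!k. ?P k" by blast
  then have P: "?P (flag_exponents n \<pi>)"
    unfolding flag_exponents_def by (rule theI')
  show "flag_prod (flag_exponents n \<pi>) n = \<pi>"
    by (rule conjunct2[OF P, symmetric])
  show "\<And>i. i < n \<Longrightarrow> flag_exponents n \<pi> i \<le> i"
    using conjunct1[OF P] by (auto simp: PiE_iff less_Suc_eq_le)
qed

theorem claim1:
  fixes n :: nat and \<pi> :: "nat \<Rightarrow> nat"
  assumes "n \<ge> 1" and "\<pi> permutes {1..n}"
  shows "flag_major n \<pi> = major n \<pi>"
proof -
  have "major n (flag_prod (flag_exponents n \<pi>) n) = flag_major n \<pi>"
    unfolding flag_major_def
    by (rule major_flag_prod) (rule flag_exponents_flag_prod(1)[OF assms(2)])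
  then show ?thesis
    by (simp only: flag_exponents_flag_prod(2)[OF assms(2)])
qed

end
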